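(* In the graceful game, Bob has a winning strategy on every gear graph $G_n$, $n\geq 3$ (no matter who starts).
   Context: The gear graph $G_n$ ($n\geq 3$) is obtained from the wheel $W_n$ (a cycle $(v_0,\dots,v_{n-1})$ plus a central vertex $v_n$ adjacent to all $v_0,\dots,v_{n-1}$) by subdividing each edge $v_jv_{j+1}$ of the outer cycle exactly once, by a new vertex $w_j$ (indices mod $n$). It has $2n+1$ vertices and $3n$ edges. A graceful labeling of a graph $G$ with $m$ edges is an injective map $f\colon V(G)\to\{0,1,\dots,m\}$ such that the induced edge labels $|f(u)-f(v)|$, $uv\in E(G)$, are pairwise distinct. The graceful game on a simple graph $G$ with $m$ edges: two players, Alice and Bob, alternately choose a free (not yet labeled) vertex and assign to it a label from $\{0,1,\dots,m\}$ not yet used. An edge both of whose endpoints are labeled gets label $|f(u)-f(v)|$; a move is legal only if after it all edge labels are pairwise distinct. Alice wins if the whole graph ends up gracefully labeled; Bob wins if he can prevent this. Either player may be the first to move. *)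

theory Defs
  imports Main
begin

definition simple_graph :: "'v set \<Rightarrow> 'v set set \<Rightarrow> bool" where
  "simple_graph V E \<longleftrightarrow> finite V \<and> (\<forall>e\<in>E. e \<subseteq> V \<and> card e = 2)"

definition distinct_edge_labels :: "'v set set \<Rightarrow> ('v \<Rightarrow> nat) \<Rightarrow> bool" where
  "distinct_edge_labels E f \<longleftrightarrow>
     (\<forall>u v x y. {u, v} \<in> E \<longrightarrow> {x, y} \<in> E \<longrightarrow> {u, v} \<noteq> {x, y} \<longrightarrow>
        \<bar>int (f u) - int (f v)\<bar> \<noteq> \<bar>int (f x) - int (f y)\<bar>)"

definition graceful_labeling :: "'v set \<Rightarrow> 'v set set \<Rightarrow> ('v \<Rightarrow> nat) \<Rightarrow> bool" where
  "graceful_labeling V E f \<longleftrightarrow>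
     inj_on f V \<and> f ` V \<subseteq> {0..card E} \<and> distinct_edge_labels E f"


datatype player = Alice | Bob

fun opponent :: "player \<Rightarrow> player" where
  "opponent Alice = Bob"
| "opponent Bob = Alice"

text \<open>A move \<open>(v, a)\<close> assigns the label \<open>a\<close> to the vertex \<open>v\<close>. A play is the list of the moves
  made so far, in chronological order; since a legal play labels every vertex at most once,
  \<^const>\<open>map_of\<close> of it is the current partial labeling.\<close>

type_synonym 'v move = "'v \<times> nat"
type_synonym 'v play = "'v move list"

definition legal_move :: "'v set \<Rightarrow> 'v set set \<Rightarrow> 'v play \<Rightarrow> 'v move \<Rightarrow> bool" where
  "legal_move V E ms mv \<longleftrightarrow>
     (let p = map_of ms; v = fst mv; a = snd mv; p' = p(v \<mapsto> a) in
        v \<in> V \<and> v \<notin> dom p \<and> a \<in> {0..card E} \<and> a \<notin> ran p \<and>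
        distinct_edge_labels {e \<in> E. e \<subseteq> dom p'} (\<lambda>x. the (p' x)))"

inductive legal_play :: "'v set \<Rightarrow> 'v set set \<Rightarrow> 'v play \<Rightarrow> bool" for V E where
  start: "legal_play V E []"
| move: "legal_play V E ms \<Longrightarrow> legal_move V E ms mv \<Longrightarrow> legal_play V E (ms @ [mv])"

definition finished :: "'v set \<Rightarrow> 'v set set \<Rightarrow> 'v play \<Rightarrow> bool" where
  "finished V E ms \<longleftrightarrow> \<not> (\<exists>mv. legal_move V E ms mv)"

definition alice_wins :: "'v set \<Rightarrow> 'v set set \<Rightarrow> 'v play \<Rightarrow> bool" where
  "alice_wins V E ms \<longleftrightarrow>
     dom (map_of ms) = V \<and> graceful_labeling V E (\<lambda>x. the (map_of ms x))"

definition turn :: "player \<Rightarrow> 'v play \<Rightarrow> player" where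
  "turn first ms = (if even (length ms) then first else opponent first)"

definition follows :: "player \<Rightarrow> player \<Rightarrow> ('v play \<Rightarrow> 'v move) \<Rightarrow> 'v play \<Rightarrow> bool" where
  "follows first q \<sigma> ms \<longleftrightarrow>
     (\<forall>k < length ms. turn first (take k ms) = q \<longrightarrow> ms ! k = \<sigma> (take k ms))"

text \<open>The first conjunct makes Bob's strategy prescribe a legal move whenever he has one, so that he
  cannot win by refusing to move. Whether a move is legal does not depend on who makes it, so a
  play gets stuck for both players at once, and Bob wins if it does so before all vertices
  are labeled. Plays are finite when \<open>V\<close> is.\<close>

definition bob_winning_strategy ::
  "'v set \<Rightarrow> 'v set set \<Rightarrow> player \<Rightarrow> ('v play \<Rightarrow> 'v move) \<Rightarrow> bool" where
  "bob_winning_strategy V E first \<sigma> \<longleftrightarrow>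
     (\<forall>ms. legal_play V E ms \<and> follows first Bob \<sigma> ms \<longrightarrow>
        (turn first ms = Bob \<and> \<not> finished V E ms \<longrightarrow> legal_move V E ms (\<sigma> ms)) \<and>
        (finished V E ms \<longrightarrow> \<not> alice_wins V E ms))"


text \<open>\<open>Rim j\<close> is the outer wheel vertex \<open>v\<^sub>j\<close>, \<open>Hub\<close> the centre \<open>v\<^sub>n\<close>, and \<open>Mid j\<close> the
  vertex \<open>w\<^sub>j\<close> subdividing the outer edge from \<open>v\<^sub>j\<close> to its successor.\<close>

datatype gear_vertex = Hub | Rim nat | Mid nat

definition gear_verts :: "nat \<Rightarrow> gear_vertex set" where
  "gear_verts n = {Hub} \<union> Rim ` {..<n} \<union> Mid ` {..<n}"

definition gear_edges :: "nat \<Rightarrow> gear_vertex set set" where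
  "gear_edges n =
     (\<Union>j<n. {{Hub, Rim j}, {Rim j, Mid j}, {Mid j, Rim ((j + 1) mod n)}})"

lemma simple_graph_gear: "simple_graph (gear_verts n) (gear_edges n)"
  by (auto simp: simple_graph_def gear_verts_def gear_edges_def card_insert_if)

lemma card_gear_verts: "card (gear_verts n) = 2 * n + 1"
proof -
  have "card (Rim ` {..<n} \<union> Mid ` {..<n}) = 2 * n"
    by (subst card_Un_disjoint) (auto simp: card_image inj_on_def)
  moreover have "gear_verts n = insert Hub (Rim ` {..<n} \<union> Mid ` {..<n})"
    by (auto simp: gear_verts_def)
  moreover have "Hub \<notin> Rim ` {..<n} \<union> Mid ` {..<n}" by auto
  ultimately show ?thesis by simp
qed

lemma card_gear_edges:
  assumes "n \<ge> 3"
  shows "card (gear_edges n) = 3 * n"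
proof -
  let ?A = "(\<lambda>j. {Hub, Rim j}) ` {..<n}"
  let ?B = "(\<lambda>j. {Rim j, Mid j}) ` {..<n}"
  let ?C = "(\<lambda>j. {Mid j, Rim ((j + 1) mod n)}) ` {..<n}"
  have eq: "gear_edges n = ?A \<union> (?B \<union> ?C)" by (auto simp: gear_edges_def)
  have cards: "card ?A = n" "card ?B = n" "card ?C = n"
    by (auto simp: card_image inj_on_def doubleton_eq_iff)
  have ne: "(j + 1) mod n \<noteq> j" if "j < n" for j
    using that assms by (cases "j + 1 = n") auto
  have BC: "?B \<inter> ?C = {}" using ne by (auto simp: doubleton_eq_iff)
  have ABC: "?A \<inter> (?B \<union> ?C) = {}" by (auto simp: doubleton_eq_iff)
  have "card (?B \<union> ?C) = 2 * n" using cards BC by (subst card_Un_disjoint) auto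
  then show ?thesis unfolding eq using cards ABC by (subst card_Un_disjoint) auto
qed

end

theory Submission
  imports Defs
begin

text \<open>With \<open>m = 3n\<close> edges, a graceful labeling attains every edge label \<open>1, \<dots>, m\<close>. So \<open>0\<close> and \<open>m\<close>
  must be adjacent, and edge label \<open>m - 1\<close> needs an edge labeled \<open>{0, m - 1}\<close> or \<open>{1, m}\<close>.
  Bob puts \<open>0\<close> on a vertex \<open>w\<close> with at most two free neighbours: a subdivision vertex, or a rim
  vertex one of whose neighbours Alice has already labeled. If Alice's answer is on the side of
  \<open>w\<close> in the bipartition, Bob separates \<open>m\<close> from \<open>0\<close> by playing it on that side as well.
  Otherwise the labeled edges form a star at \<open>w\<close>, and Bob plays the least unused positive label
  on a free neighbour of \<open>w\<close>. Then at most one neighbour of \<open>w\<close> can get a label in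
  \<open>{m - 1, m}\<close>, and \<open>1\<close> is on the side opposite to \<open>w\<close>, where \<open>m\<close> has to go, so
  edge label \<open>m - 1\<close> is lost. Replacing each label \<open>a\<close> by \<open>m - a\<close> allows us to assume that
  Alice's first label is at most \<open>m / 2\<close>, which keeps Bob's moves legal; only \<open>m / 2\<close> on the hub
  needs a separate answer.\<close>

section \<open>Positions won by Bob, and the strategy they yield\<close>

text \<open>Speaks of graceful labelings instead of continuations of the play, so that it can be
  verified by counting edge labels alone.\<close>

definition doomed :: "'v set \<Rightarrow> 'v set set \<Rightarrow> 'v play \<Rightarrow> bool" where
  "doomed V E ms \<longleftrightarrow>
     (\<forall>f. graceful_labeling V E f \<longrightarrow> (\<exists>v a. map_of ms v = Some a \<and> f v \<noteq> a))"

text \<open>Bob's winning game trees with doomed leaves. The length bound in \<open>alice\<close>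
  keeps a vertex unlabeled, so a position where Alice has no move is rightly won by Bob rather than
  a completed labeling.\<close>

inductive bob_wins :: "'v set \<Rightarrow> 'v set set \<Rightarrow> player \<Rightarrow> 'v play \<Rightarrow> bool" for V E first where
  doomed: "doomed V E ms \<Longrightarrow> bob_wins V E first ms"
| bob: "turn first ms = Bob \<Longrightarrow> legal_move V E ms mv \<Longrightarrow> bob_wins V E first (ms @ [mv]) \<Longrightarrow>
    bob_wins V E first ms"
| alice: "turn first ms = Alice \<Longrightarrow> length ms < card V \<Longrightarrow>
    (\<And>mv. legal_move V E ms mv \<Longrightarrow> bob_wins V E first (ms @ [mv])) \<Longrightarrow> bob_wins V E first ms"

text \<open>\<open>map_of\<close> lets earlier entries of an append take precedence, so later moves
  never overwrite a label.\<close>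

lemma doomed_append: "doomed V E ms \<Longrightarrow> doomed V E (ms @ ms')"
  unfolding doomed_def by (fastforce simp: map_add_Some_iff)

lemma not_alice_wins_if_short:
  assumes "length ms < card V"
  shows "\<not> alice_wins V E ms"
proof
  assume "alice_wins V E ms"
  then have "V = fst ` set ms" by (simp add: alice_wins_def dom_map_of_conv_image_fst)
  then have "card V \<le> length ms" by (metis card_image_le card_length finite_set le_trans)
  with assms show False by simp
qed

lemma not_alice_wins_if_doomed: "doomed V E ms \<Longrightarrow> \<not> alice_wins V E ms"
  unfolding doomed_def alice_wins_def by (metis option.sel)

text \<open>The rule \<open>bob\<close> exhibits a legal move, so a finished play stems from one of
  the other rules: it is doomed or too short to label every vertex.\<close>

lemma bob_wins_not_alice_wins:
  "bob_wins V E first ms \<Longrightarrow> finished V E ms \<Longrightarrow> \<not> alice_wins V E ms"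
  by (erule bob_wins.cases)
    (auto simp: finished_def dest: not_alice_wins_if_doomed not_alice_wins_if_short)

text \<open>In a doomed position any legal move will do, since doom persists.\<close>

lemma bob_wins_bob_move:
  "bob_wins V E first ms \<Longrightarrow> turn first ms = Bob \<Longrightarrow> \<not> finished V E ms \<Longrightarrow>
    \<exists>mv. legal_move V E ms mv \<and> bob_wins V E first (ms @ [mv])"
  by (erule bob_wins.cases) (auto simp: finished_def intro: bob_wins.doomed doomed_append)

lemma bob_wins_alice_move:
  "bob_wins V E first ms \<Longrightarrow> turn first ms = Alice \<Longrightarrow> legal_move V E ms mv \<Longrightarrow>
    bob_wins V E first (ms @ [mv])"
  by (erule bob_wins.cases) (auto intro: bob_wins.doomed doomed_append)

text \<open>If Bob always picks some legal move that stays in \<open>bob_wins\<close>, then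
  \<open>bob_wins\<close> is an invariant of all plays following this strategy.\<close>

lemma bob_winning_strategy_if_bob_wins:
  assumes "bob_wins V E first []"
  shows "\<exists>\<sigma>. bob_winning_strategy V E first \<sigma>"
proof -
  define \<sigma> where
    "\<sigma> ms = (SOME mv. legal_move V E ms mv \<and> bob_wins V E first (ms @ [mv]))" for ms
  have \<sigma>: "legal_move V E ms (\<sigma> ms) \<and> bob_wins V E first (ms @ [\<sigma> ms])"
    if "bob_wins V E first ms" "turn first ms = Bob" "\<not> finished V E ms" for ms
    unfolding \<sigma>_def using bob_wins_bob_move[OF that] by (rule someI_ex)
  have inv: "bob_wins V E first ms" if "legal_play V E ms" "follows first Bob \<sigma> ms" for ms
    using that
  proof (induction rule: legal_play.induct)
    case start
    show ?case by (rule assms)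
  next
    case (move ms mv)
    have "follows first Bob \<sigma> ms"
      unfolding follows_def
    proof (intro allI impI)
      fix k assume k: "k < length ms" "turn first (take k ms) = Bob"
      with move.prems have "(ms @ [mv]) ! k = \<sigma> (take k (ms @ [mv]))"
        unfolding follows_def by auto
      with k show "ms ! k = \<sigma> (take k ms)" by (simp add: nth_append)
    qed
    then have W: "bob_wins V E first ms" by (rule move.IH)
    show ?case
    proof (cases "turn first ms")
      case Alice
      then show ?thesis using W move.hyps bob_wins_alice_move by blast
    next
      case Bob
      have "turn first (take (length ms) (ms @ [mv])) = Bob \<longrightarrow>
          (ms @ [mv]) ! length ms = \<sigma> (take (length ms) (ms @ [mv]))"
        using move.prems unfolding follows_def by (metis length_append_singleton lessI)
      then have "mv = \<sigma> ms" using Bob by simp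
      then show ?thesis using \<sigma>[OF W Bob] move.hyps(2) unfolding finished_def by blast
    qed
  qed
  show ?thesis
    unfolding bob_winning_strategy_def using inv \<sigma> bob_wins_not_alice_wins by blast
qed

section \<open>Legality of moves\<close>

lemma map_of_snoc:
  "v \<notin> dom (map_of ms) \<Longrightarrow> map_of (ms @ [(v, a)]) = (map_of ms)(v \<mapsto> a)"
  by (auto simp: map_add_def fun_eq_iff split: option.splits)

lemma legal_play_distinct_edge_labels:
  "legal_play V E ms \<Longrightarrow>
    distinct_edge_labels {e \<in> E. e \<subseteq> dom (map_of ms)} (\<lambda>x. the (map_of ms x))"
proof (induction rule: legal_play.induct)
  case start
  then show ?case by (auto simp: distinct_edge_labels_def)
next
  case (move ms mv)
  obtain v a where mv: "mv = (v, a)" by (cases mv)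
  have v: "v \<notin> dom (map_of ms)" using move.hyps by (simp add: legal_move_def Let_def mv)
  show ?case
    using move.hyps(2) unfolding legal_move_def Let_def mv map_of_snoc[OF v] fst_conv snd_conv by blast
qed

lemma legal_play_verts: "legal_play V E ms \<Longrightarrow> map_of ms v = Some a \<Longrightarrow> v \<in> V"
proof (induction arbitrary: v a rule: legal_play.induct)
  case (move ms mv)
  then show ?case by (cases mv) (auto simp: legal_move_def Let_def split: if_splits)
qed simp

text \<open>If \<open>z\<close> is the only possible labeled neighbour of \<open>v\<close>, the move
  creates at most one new edge label, which just has to avoid the old ones. When \<open>v\<close>
  has no labeled neighbour, \<open>z\<close> is a dummy and \<open>new\<close> is vacuous.\<close>

lemma legal_move_one_neighbour:
  assumes play: "legal_play V E ms" and v: "v \<in> V" "map_of ms v = None"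
    and a: "a \<le> card E" "\<And>t. map_of ms t \<noteq> Some a"
    and loop: "{v} \<notin> E"
    and nbr: "\<And>t b. {v, t} \<in> E \<Longrightarrow> map_of ms t = Some b \<Longrightarrow> t = z"
    and new: "\<And>b s s' c c'. {v, z} \<in> E \<Longrightarrow> map_of ms z = Some b \<Longrightarrow> {s, s'} \<in> E \<Longrightarrow>
      map_of ms s = Some c \<Longrightarrow> map_of ms s' = Some c' \<Longrightarrow>
      \<bar>int a - int b\<bar> \<noteq> \<bar>int c - int c'\<bar>"
  shows "legal_move V E ms (v, a)"
proof -
  let ?p = "map_of ms"
  let ?q = "?p(v \<mapsto> a)"
  let ?d = "\<lambda>s t. \<bar>int (the (?q s)) - int (the (?q t))\<bar>"
  have old: "\<bar>int (the (?p s)) - int (the (?p t))\<bar> \<noteq> \<bar>int (the (?p x)) - int (the (?p y))\<bar>"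
    if "{s, t} \<in> E" "{x, y} \<in> E" "{s, t} \<noteq> {x, y}" "{s, t, x, y} \<subseteq> dom ?p" for s t x y
    using legal_play_distinct_edge_labels[OF play] that
    unfolding distinct_edge_labels_def by simp
  have at_v: "{s, t} = {v, z} \<and> z \<in> dom ?p \<and> z \<noteq> v"
    if h: "{s, t} \<in> E" "{s, t} \<subseteq> dom ?q" "v \<in> {s, t}" for s t
  proof -
    have st: "s \<noteq> t" using h loop by auto
    obtain t' where t': "{s, t} = {v, t'}" "t' \<noteq> v" using h(3) st by (cases "v = s") auto
    then have "t' \<in> dom ?p" using h(2) by (auto simp: doubleton_eq_iff)
    moreover from this have "t' = z" using nbr[of t'] h(1) t'(1) by auto
    ultimately show ?thesis using t' by simp
  qed
  have d_vz: "?d s t = \<bar>int a - int (the (?p z))\<bar>" if "{s, t} = {v, z}" "z \<noteq> v" for s t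
    using that by (auto simp: doubleton_eq_iff)
  have new': "?d s t \<noteq> ?d x y"
    if h: "{s, t} \<in> E" "{x, y} \<in> E" "{s, t} \<subseteq> dom ?q" "{x, y} \<subseteq> dom ?q"
      "v \<in> {s, t}" "v \<notin> {x, y}" for s t x y
  proof -
    from at_v[OF h(1,3,5)] have z: "{s, t} = {v, z}" "z \<in> dom ?p" "z \<noteq> v" by auto
    obtain b where b: "?p z = Some b" using z by auto
    obtain c c' where c: "?p x = Some c" "?p y = Some c'" using h by auto
    have "{v, z} \<in> E" using h(1) z(1) by simp
    moreover have "x \<noteq> v" "y \<noteq> v" using h(6) by auto
    ultimately show ?thesis using new[OF _ b h(2) c] d_vz[OF z(1,3)] b c by simp
  qed
  have "distinct_edge_labels {e \<in> E. e \<subseteq> dom ?q} (\<lambda>x. the (?q x))"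
    unfolding distinct_edge_labels_def
  proof (intro allI impI)
    fix s t x y
    assume "{s, t} \<in> {e \<in> E. e \<subseteq> dom ?q}" "{x, y} \<in> {e \<in> E. e \<subseteq> dom ?q}"
      and ne: "{s, t} \<noteq> {x, y}"
    then have E: "{s, t} \<in> E" "{x, y} \<in> E" "{s, t} \<subseteq> dom ?q" "{x, y} \<subseteq> dom ?q" by auto
    \<comment> \<open>Two distinct edges cannot both contain \<open>v\<close>, as each would be
      \<open>{v, z}\<close>; the mixed cases compare the new label with an old one.\<close>
    consider "v \<in> {s, t}" "v \<in> {x, y}" | "v \<in> {s, t}" "v \<notin> {x, y}"
      | "v \<notin> {s, t}" "v \<in> {x, y}" | "v \<notin> {s, t}" "v \<notin> {x, y}" by blast
    then show "?d s t \<noteq> ?d x y"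
    proof cases
      case 1
      then show ?thesis using at_v E ne by metis
    next
      case 2
      then show ?thesis using new' E by blast
    next
      case 3
      then show ?thesis using new'[of x y s t] E by metis
    next
      case 4
      then show ?thesis using old[of s t x y] E ne by auto
    qed
  qed
  then show ?thesis using v a by (auto simp: legal_move_def Let_def ran_def)
qed

section \<open>Complementing all labels\<close>

text \<open>Subtraction on \<open>nat\<close> truncates, so this is an involution only on labels at
  most \<open>k\<close>; the lemmas below therefore carry that bound.\<close>

definition complement_play :: "nat \<Rightarrow> 'v play \<Rightarrow> 'v play" where
  "complement_play k = map (\<lambda>(v, a). (v, k - a))"

lemma map_of_complement_play: "map_of (complement_play k ms) = map_option (\<lambda>a. k - a) \<circ> map_of ms"
  unfolding complement_play_def by (rule map_of_map)

lemma length_complement_play [simp]: "length (complement_play k ms) = length ms"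
  by (simp add: complement_play_def)

lemma complement_play_snoc:
  "complement_play k (ms @ [(v, a)]) = complement_play k ms @ [(v, k - a)]"
  by (simp add: complement_play_def)

lemma complement_play_complement_play:
  "\<forall>(v, a)\<in>set ms. a \<le> k \<Longrightarrow> complement_play k (complement_play k ms) = ms"
  by (auto simp: complement_play_def comp_def intro!: map_idI)

lemma distinct_edge_labels_complement:
  assumes "distinct_edge_labels E f" "\<And>e x. e \<in> E \<Longrightarrow> x \<in> e \<Longrightarrow> f x \<le> k \<and> g x = k - f x"
  shows "distinct_edge_labels E g"
proof -
  have "\<bar>int (g u) - int (g v)\<bar> = \<bar>int (f u) - int (f v)\<bar>" if "{u, v} \<in> E" for u v
    using assms(2)[OF that, of u] assms(2)[OF that, of v] by auto
  with assms(1) show ?thesis unfolding distinct_edge_labels_def by simp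
qed

lemma legal_move_complement:
  assumes le: "\<forall>(v, a)\<in>set ms. a \<le> card E" and legal: "legal_move V E ms (v, a)"
  shows "legal_move V E (complement_play (card E) ms) (v, card E - a)"
proof -
  let ?k = "card E"
  let ?p = "map_of ms" and ?p' = "map_of (complement_play ?k ms)"
  have p': "?p' = map_option (\<lambda>a. ?k - a) \<circ> ?p" by (rule map_of_complement_play)
  have dom: "dom ?p' = dom ?p" unfolding p' by auto
  have l: "v \<in> V" "v \<notin> dom ?p" "a \<le> ?k" "a \<notin> ran ?p"
    and d: "distinct_edge_labels {e \<in> E. e \<subseteq> dom (?p(v \<mapsto> a))} (\<lambda>x. the ((?p(v \<mapsto> a)) x))"
    using legal by (auto simp: legal_move_def Let_def)
  have le': "b \<le> ?k" if "?p t = Some b" for t b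
    using le map_of_SomeD[OF that] by auto
  have "?k - a \<notin> ran ?p'"
  proof
    assume "?k - a \<in> ran ?p'"
    then obtain t b where "?p t = Some b" "?k - a = ?k - b" unfolding p' ran_def by auto
    then have "a = b" using le' l(3) by (metis diff_diff_cancel)
    with l(4) \<open>?p t = Some b\<close> show False by (auto simp: ran_def)
  qed
  moreover have "distinct_edge_labels {e \<in> E. e \<subseteq> dom (?p'(v \<mapsto> ?k - a))}
      (\<lambda>x. the ((?p'(v \<mapsto> ?k - a)) x))"
  proof -
    have "distinct_edge_labels {e \<in> E. e \<subseteq> dom (?p(v \<mapsto> a))}
      (\<lambda>x. the ((?p'(v \<mapsto> ?k - a)) x))"
    proof (rule distinct_edge_labels_complement[OF d])
      fix e x assume "e \<in> {e \<in> E. e \<subseteq> dom (?p(v \<mapsto> a))}" "x \<in> e"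
      then have "x = v \<or> x \<in> dom ?p" by auto
      then show "the ((?p(v \<mapsto> a)) x) \<le> ?k \<and>
          the ((?p'(v \<mapsto> ?k - a)) x) = ?k - the ((?p(v \<mapsto> a)) x)"
        using l(3) le' unfolding p' by auto
    qed
    then show ?thesis by (simp add: dom)
  qed
  ultimately show ?thesis using l unfolding legal_move_def Let_def by (simp add: dom)
qed

lemma graceful_labeling_complement:
  assumes "graceful_labeling V E f" "\<And>e. e \<in> E \<Longrightarrow> e \<subseteq> V"
  shows "graceful_labeling V E (\<lambda>v. card E - f v)"
proof -
  have le: "f v \<le> card E" if "v \<in> V" for v
    using assms(1) that by (auto simp: graceful_labeling_def)
  have "inj_on (\<lambda>v. card E - f v) V"
  proof (rule inj_onI)
    fix x y assume xy: "x \<in> V" "y \<in> V" "card E - f x = card E - f y"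
    then have "f x = f y" using le[OF xy(1)] le[OF xy(2)] by linarith
    with xy assms(1) show "x = y" by (auto simp: graceful_labeling_def dest: inj_onD)
  qed
  moreover have "distinct_edge_labels E (\<lambda>v. card E - f v)"
  proof (rule distinct_edge_labels_complement)
    show "distinct_edge_labels E f" using assms(1) by (simp add: graceful_labeling_def)
    fix e x assume "e \<in> E" "x \<in> e"
    then have "x \<in> V" using assms(2) by blast
    then show "f x \<le> card E \<and> card E - f x = card E - f x" using le by simp
  qed
  ultimately show ?thesis by (auto simp: graceful_labeling_def)
qed

lemma doomed_complement:
  assumes "doomed V E ms" "\<forall>(v, a)\<in>set ms. a \<le> card E" "\<And>e. e \<in> E \<Longrightarrow> e \<subseteq> V"
  shows "doomed V E (complement_play (card E) ms)"
  unfolding doomed_def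
proof (intro allI impI)
  fix f assume f: "graceful_labeling V E f"
  from graceful_labeling_complement[OF this assms(3)] assms(1)
  obtain v a where v: "map_of ms v = Some a" "card E - f v \<noteq> a"
    unfolding doomed_def by meson
  then have "a \<le> card E" using assms(2) map_of_SomeD[OF v(1)] by auto
  with v show "\<exists>v a. map_of (complement_play (card E) ms) v = Some a \<and> f v \<noteq> a"
    by (intro exI[of _ v] exI[of _ "card E - a"]) (auto simp: map_of_complement_play)
qed

text \<open>Reflecting labels preserves differences, hence legality and doom, so Bob's whole game
  tree can be reflected.\<close>

lemma bob_wins_complement:
  assumes "bob_wins V E first ms" "\<forall>(v, a)\<in>set ms. a \<le> card E" "\<And>e. e \<in> E \<Longrightarrow> e \<subseteq> V"
  shows "bob_wins V E first (complement_play (card E) ms)"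
  using assms(1,2)
proof (induction rule: bob_wins.induct)
  case (doomed ms)
  then show ?case using doomed_complement assms(3) bob_wins.doomed by blast
next
  case (bob ms mv)
  obtain v a where mv: "mv = (v, a)" by (cases mv)
  have "a \<le> card E" using bob.hyps(2) by (simp add: legal_move_def Let_def mv)
  then have "bob_wins V E first (complement_play (card E) ms @ [(v, card E - a)])"
    using bob.IH bob.prems by (auto simp: mv complement_play_snoc)
  moreover have "legal_move V E (complement_play (card E) ms) (v, card E - a)"
    using legal_move_complement[OF bob.prems, of V v a] bob.hyps(2) mv by simp
  moreover have "turn first (complement_play (card E) ms) = Bob"
    using bob.hyps(1) by (simp add: turn_def)
  ultimately show ?case using bob_wins.bob by metis
next
  case (alice ms)
  let ?c = "complement_play (card E)"
  show ?case
  proof (rule bob_wins.alice)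
    show "turn first (?c ms) = Alice" using alice.hyps(1) by (simp add: turn_def)
    show "length (?c ms) < card V" using alice.hyps(2) by simp
    fix mv assume mv_legal: "legal_move V E (?c ms) mv"
    obtain v a where mv: "mv = (v, a)" by (cases mv)
    have a: "a \<le> card E" using mv_legal by (simp add: legal_move_def Let_def mv)
    \<comment> \<open>Alice's move in the reflected position is reflected back, to reach the
      position covered by the induction hypothesis.\<close>
    have "legal_move V E (?c (?c ms)) (v, card E - a)"
      by (rule legal_move_complement) (use mv_legal mv in \<open>auto simp: complement_play_def\<close>)
    then have "legal_move V E ms (v, card E - a)"
      using complement_play_complement_play[OF alice.prems] by simp
    from alice.IH[OF this] alice.prems a show "bob_wins V E first (?c ms @ [mv])"
      by (auto simp: mv complement_play_snoc)
  qed
qed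

section \<open>Edge labels of graceful labelings and criteria for doom\<close>

text \<open>Pigeonhole: the edge labels map \<open>E\<close> injectively into
  \<open>{1..card E}\<close>, a set of the same size.\<close>

lemma graceful_edge_label_attained:
  assumes f: "graceful_labeling V E f" and G: "simple_graph V E" and "1 \<le> k" "k \<le> card E"
  shows "\<exists>u v. {u, v} \<in> E \<and> f v = f u + k"
proof -
  \<comment> \<open>Edges are unordered sets; maximum minus minimum gives the label as a function of
    the set.\<close>
  define lab where "lab e = Max (f ` e) - Min (f ` e)" for e
  have lab: "lab {u, v} = nat \<bar>int (f u) - int (f v)\<bar>" for u v
    by (auto simp: lab_def max_def min_def)
  have edge: "\<exists>u v. e = {u, v} \<and> u \<noteq> v \<and> u \<in> V \<and> v \<in> V" if "e \<in> E" for e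
    using G that unfolding simple_graph_def by (metis card_2_iff insert_subset)
  have "inj_on lab E"
  proof (rule inj_onI)
    fix e e' assume *: "e \<in> E" "e' \<in> E" "lab e = lab e'"
    obtain u v x y where "e = {u, v}" "e' = {x, y}" using edge * by metis
    moreover from this * have
      "\<bar>int (f u) - int (f v)\<bar> = \<bar>int (f x) - int (f y)\<bar>" by (simp add: lab eq_nat_nat_iff)
    ultimately show "e = e'"
      using f *(1,2) unfolding graceful_labeling_def distinct_edge_labels_def by blast
  qed
  moreover have "lab ` E \<subseteq> {1..card E}"
  proof
    fix l assume "l \<in> lab ` E"
    then obtain e where "e \<in> E" "l = lab e" by blast
    then obtain u v where uv: "u \<noteq> v" "u \<in> V" "v \<in> V" "l = lab {u, v}" using edge by metis
    have "f u \<noteq> f v" using f uv by (auto simp: graceful_labeling_def dest: inj_onD)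
    moreover have "f u \<le> card E" "f v \<le> card E" using f uv by (auto simp: graceful_labeling_def)
    ultimately show "l \<in> {1..card E}" unfolding uv(4) lab by auto
  qed
  ultimately have "lab ` E = {1..card E}"
    by (intro card_subset_eq) (auto simp: card_image)
  then obtain e where e: "e \<in> E" "lab e = k" using assms(3,4) by (metis atLeastAtMost_iff imageE)
  obtain u v where uv: "e = {u, v}" using edge[OF e(1)] by blast
  show ?thesis
  proof (cases "f u \<le> f v")
    case True
    then show ?thesis using e uv lab[of u v] by (intro exI[of _ u] exI[of _ v]) auto
  next
    case False
    then show ?thesis using e uv lab[of u v]
      by (intro exI[of _ v] exI[of _ u]) (auto simp: insert_commute)
  qed
qed

text \<open>The edge label \<open>card E\<close> must occur, and it arises only as the difference of
  \<open>card E\<close> and 0.\<close>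

lemma graceful_extreme_labels_adjacent:
  assumes "graceful_labeling V E f" "simple_graph V E" "card E \<ge> 1"
    and "u \<in> V" "f u = 0" "v \<in> V" "f v = card E"
  shows "{u, v} \<in> E"
proof -
  obtain s t where st: "{s, t} \<in> E" "f t = f s + card E"
    using graceful_edge_label_attained[OF assms(1,2,3)] by blast
  have V: "s \<in> V" "t \<in> V" using st(1) assms(2) by (auto simp: simple_graph_def)
  have "f t \<le> card E" using assms(1) V by (auto simp: graceful_labeling_def)
  then have "f s = f u" "f t = f v" using st assms(5,7) by auto
  then have "s = u" "t = v"
    using assms(1,4,6) V by (auto simp: graceful_labeling_def dest: inj_onD)
  with st show ?thesis by simp
qed

lemma doomed_if_extreme_labels_apart:
  assumes "simple_graph V E" "card E \<ge> 1" "u \<in> V" "v \<in> V" "{u, v} \<notin> E"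
    and "map_of ms u = Some 0" "map_of ms v = Some (card E)"
  shows "doomed V E ms"
  using graceful_extreme_labels_adjacent[OF _ assms(1-3) _ assms(4)] assms(5-7)
  unfolding doomed_def by metis

text \<open>The neighbours of \<open>w\<close> other than \<open>z\<close> carry neither of the two largest labels, so \<open>z\<close> must
  receive the largest one; then no edge can get the second largest edge label, since \<open>q\<close>,
  which carries 1, is not adjacent to \<open>z\<close>.\<close>

lemma doomed_if_one_open_neighbour:
  assumes G: "simple_graph V E" and m: "card E \<ge> 2" and w: "w \<in> V" "map_of ms w = Some 0"
    and q: "q \<in> V" "map_of ms q = Some 1"
    and apart: "\<And>t. {w, t} \<in> E \<Longrightarrow> {q, t} \<notin> E"
    and nbr: "\<And>t. {w, t} \<in> E \<Longrightarrow> t \<noteq> z \<Longrightarrow>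
      \<exists>b. map_of ms t = Some b \<and> b \<noteq> card E \<and> b \<noteq> card E - 1"
  shows "doomed V E ms"
  unfolding doomed_def
proof (rule allI, rule impI, rule ccontr)
  fix f assume f: "graceful_labeling V E f"
    and "\<nexists>v a. map_of ms v = Some a \<and> f v \<noteq> a"
  then have ext: "f v = a" if "map_of ms v = Some a" for v a using that by blast
  have inj: "s = t" if "f s = f t" "s \<in> V" "t \<in> V" for s t
    using f that by (auto simp: graceful_labeling_def dest: inj_onD)
  have EV: "s \<in> V" "t \<in> V" if "{s, t} \<in> E" for s t
    using G that by (auto simp: simple_graph_def)
  have le: "f t \<le> card E" if "t \<in> V" for t using f that by (auto simp: graceful_labeling_def)
  have z: "t = z" if "{w, t} \<in> E" "f t = card E \<or> f t = card E - 1" for t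
    using nbr[OF that(1)] that(2) ext by blast
  obtain s t where st: "{s, t} \<in> E" "f t = f s + card E"
    using graceful_edge_label_attained[OF f G, of "card E"] m by auto
  have "f s = 0" "f t = card E" using st le[of t] EV[OF st(1)] by auto
  then have "s = w" using inj[of s w] ext w EV[OF st(1)] by simp
  then have wt: "{w, t} \<in> E" "t = z" using z st \<open>f t = card E\<close> by auto
  obtain s' t' where st': "{s', t'} \<in> E" "f t' = f s' + (card E - 1)"
    using graceful_edge_label_attained[OF f G, of "card E - 1"] m by fastforce
  have V': "s' \<in> V" "t' \<in> V" using EV[OF st'(1)] by auto
  \<comment> \<open>The larger end is at most \<open>card E\<close>, which leaves 0 or 1 for the
    smaller one. With 0, the other end would be \<open>z\<close>, which already carries
    \<open>card E\<close>; with 1, the edge would join \<open>q\<close> to a neighbour of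
    \<open>w\<close>.\<close>
  have "f s' = 0 \<or> f s' = 1" using st'(2) le[OF V'(2)] m by linarith
  then show False
  proof
    assume 0: "f s' = 0"
    then have "s' = w" using inj[of s' w] ext w V' by simp
    then have "t' = z" using z st' 0 by auto
    then show False using 0 st' wt \<open>f t = card E\<close> m by auto
  next
    assume 1: "f s' = 1"
    then have "f t' = f t" using st' m \<open>f t = card E\<close> by simp
    then have "t' = t" using inj V' EV[OF st(1)] by blast
    moreover have "s' = q" using 1 inj[of s' q] ext q V' by simp
    ultimately show False using apart[OF wt(1)] st' by simp
  qed
qed

lemma bob_wins_by_killing_move:
  "turn first ms = Bob \<Longrightarrow> legal_move V E ms mv \<Longrightarrow> doomed V E (ms @ [mv]) \<Longrightarrow>
    bob_wins V E first ms"
  by (rule bob_wins.bob[OF _ _ bob_wins.doomed])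

lemma legal_moveD:
  assumes "legal_move V E ms (v, a)"
  shows "v \<in> V" "map_of ms v = None" "a \<le> card E" "\<And>t. map_of ms t \<noteq> Some a"
  using assms by (auto simp: legal_move_def Let_def ran_def)

section \<open>The gear graph as a bipartite graph\<close>

text \<open>Tells the two sides of the bipartition apart: the rim vertices against the hub and the
  subdivision vertices.\<close>

definition rim :: "gear_vertex \<Rightarrow> bool" where
  "rim v \<longleftrightarrow> v \<in> range Rim"

lemma rim_simps [simp]: "rim (Rim j)" "\<not> rim Hub" "\<not> rim (Mid j)"
  by (auto simp: rim_def)

lemma gear_verts_simps [simp]:
  "Hub \<in> gear_verts n" "Rim j \<in> gear_verts n \<longleftrightarrow> j < n" "Mid j \<in> gear_verts n \<longleftrightarrow> j < n"
  by (auto simp: gear_verts_def)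

text \<open>The successor modulo \<open>n\<close> by cases, which suits case splitting better than
  \<open>mod\<close>.\<close>

definition cyclic_Suc :: "nat \<Rightarrow> nat \<Rightarrow> nat" where
  "cyclic_Suc n j = (if Suc j = n then 0 else Suc j)"

lemma Suc_mod_eq_cyclic_Suc: "j < n \<Longrightarrow> Suc j mod n = cyclic_Suc n j"
  by (auto simp: cyclic_Suc_def)

lemma gear_edges_simps [simp]:
  "{Hub, Rim k} \<in> gear_edges n \<longleftrightarrow> k < n"
  "{Rim k, Hub} \<in> gear_edges n \<longleftrightarrow> k < n"
  "{Rim k, Mid j} \<in> gear_edges n \<longleftrightarrow> j < n \<and> (k = j \<or> k = cyclic_Suc n j)"
  "{Mid j, Rim k} \<in> gear_edges n \<longleftrightarrow> j < n \<and> (k = j \<or> k = cyclic_Suc n j)"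
  by (auto simp: gear_edges_def doubleton_eq_iff Suc_mod_eq_cyclic_Suc)

lemma gear_edges_bipartite: "{u, v} \<in> gear_edges n \<Longrightarrow> rim u \<noteq> rim v"
  by (auto simp: gear_edges_def doubleton_eq_iff)

lemma gear_edges_no_loop: "{v} \<notin> gear_edges n"
  using gear_edges_bipartite[of v v n] by auto

lemma gear_edges_in_verts: "e \<in> gear_edges n \<Longrightarrow> e \<subseteq> gear_verts n"
  using simple_graph_gear[of n] by (simp add: simple_graph_def)

section \<open>Bob's killing moves once 0 is placed\<close>

text \<open>Bob puts \<open>m\<close> on \<open>z\<close>, on the same side as \<open>w\<close>, so
  0 and \<open>m\<close> are not adjacent. Only \<open>y\<close> is labeled on the other side, so
  every labeled edge ends in \<open>y\<close> and the one possible new edge label is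
  \<open>m - x\<close>.\<close>

lemma bob_wins_by_separating_extremes:
  fixes n :: nat
  defines "V \<equiv> gear_verts n" and "E \<equiv> gear_edges n" and "m \<equiv> 3 * n"
  assumes n: "n \<ge> 3" and play: "legal_play V E ms" and Bob: "turn first ms = Bob"
    and w: "w \<in> V" "map_of ms w = Some 0"
    and other: "\<And>t b. map_of ms t = Some b \<Longrightarrow> rim t \<noteq> rim w \<Longrightarrow> t = y \<and> b = x"
    and zero: "\<And>t. map_of ms t = Some 0 \<Longrightarrow> t = w"
    and x: "2 * x \<le> m" and z: "z \<in> V" "map_of ms z = None" "rim z = rim w"
    and m: "\<And>t. map_of ms t \<noteq> Some m"
    and half: "{z, y} \<in> E \<Longrightarrow> {y, w} \<in> E \<Longrightarrow> 2 * x \<noteq> m"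
  shows "bob_wins V E first ms"
proof -
  have cE: "card E = m" using n by (simp add: E_def m_def card_gear_edges)
  have "legal_move V E ms (z, m)"
  proof (rule legal_move_one_neighbour[OF play z(1,2), where z = y])
    show "m \<le> card E" using cE by simp
    show "map_of ms t \<noteq> Some m" for t by (rule m)
    show "{z} \<notin> E" unfolding E_def by (rule gear_edges_no_loop)
    show "t = y" if "{z, t} \<in> E" "map_of ms t = Some b" for t b
      using other[OF that(2)] gear_edges_bipartite that(1) z(3) unfolding E_def by blast
    fix b s s' c c'
    assume zy: "{z, y} \<in> E" and b: "map_of ms y = Some b" and E: "{s, s'} \<in> E"
      and c: "map_of ms s = Some c" "map_of ms s' = Some c'"
    have y: "rim y \<noteq> rim w" using gear_edges_bipartite zy z(3) unfolding E_def by blast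
    then have bx: "b = x" using other[OF b] by simp
    have "x \<noteq> 0" using zero[of y] b bx y by auto
    \<comment> \<open>As \<open>2 * x \<le> m\<close>, a label \<open>d\<close> strictly between 0
      and \<open>m\<close> differs from \<open>x\<close> by less than \<open>m - x\<close>. For
      \<open>d = 0\<close> a clash would need \<open>2 * x = m\<close>, which \<open>half\<close>
      excludes.\<close>
    have key: "\<bar>int m - int x\<bar> \<noteq> \<bar>int x - int d\<bar>"
      if "{y, t} \<in> E" "map_of ms t = Some d" for t d
    proof (cases "d = 0")
      case True
      then have "t = w" using zero that(2) by simp
      then show ?thesis using half zy that(1) x True by auto
    next
      case False
      moreover have "d \<noteq> m" using m that(2) by auto
      ultimately show ?thesis using x by linarith
    qed
    have "rim s \<noteq> rim s'" using gear_edges_bipartite E unfolding E_def by blast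
    then consider "rim s \<noteq> rim w" | "rim s' \<noteq> rim w" by blast
    then show "\<bar>int m - int b\<bar> \<noteq> \<bar>int c - int c'\<bar>"
    proof cases
      case 1
      then show ?thesis using other[OF c(1)] key[of s' c'] E c bx by auto
    next
      case 2
      then have "s' = y" "c' = x" using other[OF c(2)] by auto
      moreover from this have "{y, s} \<in> E" using E by (simp add: insert_commute)
      ultimately show ?thesis using key[of s c] c bx by (simp add: abs_minus_commute)
    qed
  qed
  moreover have "doomed V E (ms @ [(z, m)])"
  proof (rule doomed_if_extreme_labels_apart)
    show "simple_graph V E" unfolding V_def E_def by (rule simple_graph_gear)
    show "{w, z} \<notin> E" using gear_edges_bipartite z(3) unfolding E_def by blast
    show "map_of (ms @ [(z, m)]) z = Some (card E)"
      using z by (simp add: map_add_def cE)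
  qed (use cE n w z in \<open>auto simp: m_def map_add_def\<close>)
  ultimately show ?thesis using bob_wins_by_killing_move[OF Bob] by blast
qed

lemma bob_wins_by_filling_neighbour:
  fixes n :: nat
  defines "V \<equiv> gear_verts n" and "E \<equiv> gear_edges n" and "m \<equiv> 3 * n"
  assumes n: "n \<ge> 3" and play: "legal_play V E ms" and Bob: "turn first ms = Bob"
    and w: "w \<in> V" "map_of ms w = Some 0"
    and star: "\<And>t b. map_of ms t = Some b \<Longrightarrow> t \<noteq> w \<Longrightarrow> rim t \<noteq> rim w"
    and labels: "\<And>t b. map_of ms t = Some b \<Longrightarrow> b \<in> {0, x, x'}"
      "\<exists>t. map_of ms t = Some x" "\<exists>t. map_of ms t = Some x'"
    and u: "{w, u} \<in> E" "map_of ms u = None"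
    and nbr: "\<And>t. {w, t} \<in> E \<Longrightarrow> t \<noteq> u \<Longrightarrow> t \<noteq> z \<Longrightarrow>
      \<exists>b. map_of ms t = Some b \<and> b < m - 1"
  shows "bob_wins V E first ms"
proof -
  have cE: "card E = m" using n by (simp add: E_def m_def card_gear_edges)
  have uV: "u \<in> V" using u(1) gear_edges_in_verts unfolding E_def V_def by blast
  \<comment> \<open>Besides 0 only \<open>x\<close> and \<open>x'\<close> are used, so one of 1, 2,
    3 is free; 1 is skipped only if it is already placed.\<close>
  obtain l where l: "l \<in> {1, 2, 3}" "l \<noteq> x" "l \<noteq> x'" "l = 1 \<or> x = 1 \<or> x' = 1"
  proof -
    have "(1 \<noteq> x \<and> 1 \<noteq> x') \<or> (2 \<noteq> x \<and> 2 \<noteq> x' \<and> (x = 1 \<or> x' = 1)) \<or>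
        (3 \<noteq> x \<and> 3 \<noteq> x' \<and> (x = 1 \<or> x' = 1))" by linarith
    then show ?thesis using that by blast
  qed
  have lm: "l < m - 1" using l(1) n by (auto simp: m_def)
  have unused: "map_of ms t \<noteq> Some l" for t using labels(1)[of t l] l by auto
  have legal: "legal_move V E ms (u, l)"
  proof (rule legal_move_one_neighbour[OF play uV u(2), where z = w])
    show "l \<le> card E" using cE lm by simp
    show "map_of ms t \<noteq> Some l" for t by (rule unused)
    show "{u} \<notin> E" unfolding E_def by (rule gear_edges_no_loop)
    show "t = w" if "{u, t} \<in> E" "map_of ms t = Some b" for t b
      using star[OF that(2)] that(1) u(1) gear_edges_bipartite unfolding E_def by blast
    fix b s s' c c'
    assume b: "map_of ms w = Some b" and E: "{s, s'} \<in> E"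
      and c: "map_of ms s = Some c" "map_of ms s' = Some c'"
    have "rim s \<noteq> rim s'" using gear_edges_bipartite E unfolding E_def by blast
    then have "s = w \<or> s' = w" using star[OF c(1)] star[OF c(2)] by blast
    moreover have "c \<noteq> l" "c' \<noteq> l" using unused c by auto
    ultimately show "\<bar>int l - int b\<bar> \<noteq> \<bar>int c - int c'\<bar>" using b c w(2) by auto
  qed
  let ?ms = "ms @ [(u, l)]"
  have map: "map_of ?ms = (map_of ms)(u \<mapsto> l)" using u(2) by (intro map_of_snoc) auto
  \<comment> \<open>The vertex carrying 1, either \<open>u\<close> or one labeled earlier, lies
    opposite \<open>w\<close> and so shares no neighbour with it.\<close>
  obtain q where q: "map_of ?ms q = Some 1" using l(4) labels(2,3) u(2) unfolding map by force
  have "rim q \<noteq> rim w"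
  proof (cases "q = u")
    case True
    then show ?thesis using u(1) gear_edges_bipartite unfolding E_def by blast
  next
    case False
    then have "map_of ms q = Some 1" using q unfolding map by simp
    then show ?thesis using star[of q 1] w(2) by (cases "q = w") auto
  qed
  have "doomed V E ?ms"
  proof (rule doomed_if_one_open_neighbour[where w = w and q = q and z = z])
    show "simple_graph V E" unfolding V_def E_def by (rule simple_graph_gear)
    show "card E \<ge> 2" using cE n by (simp add: m_def)
    show "map_of ?ms w = Some 0" using w(2) u(2) unfolding map by auto
    show "q \<in> V"
      using legal_play.move[OF play legal] q legal_play_verts by metis
    show "{q, t} \<notin> E" if "{w, t} \<in> E" for t
      using that \<open>rim q \<noteq> rim w\<close> gear_edges_bipartite unfolding E_def by blast
    show "\<exists>b. map_of ?ms t = Some b \<and> b \<noteq> card E \<and> b \<noteq> card E - 1"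
      if "{w, t} \<in> E" "t \<noteq> z" for t
      using nbr[OF that(1) _ that(2)] lm unfolding map cE by (cases "t = u") fastforce+
  qed (use w q in auto)
  then show ?thesis using bob_wins_by_killing_move[OF Bob legal] by blast
qed

text \<open>Splits on the side of Alice's reply: the same side as \<open>w\<close> leads to
  separating the extremes, the other side to filling a neighbour. The first disjunct of
  \<open>same_side\<close> leaves room for the exceptional label \<open>m / 2\<close> on the
  hub.\<close>

lemma bob_wins_after_zero:
  fixes n :: nat
  defines "V \<equiv> gear_verts n" and "E \<equiv> gear_edges n" and "m \<equiv> 3 * n"
  assumes n: "n \<ge> 3" and play: "legal_play V E ms" and Alice: "turn first ms = Alice"
    and length: "length ms \<le> 2" and w: "w \<in> V" "map_of ms w = Some 0"
    and y: "\<And>t b. map_of ms t = Some b \<Longrightarrow> t \<noteq> w \<Longrightarrow> t = y \<and> b = x \<and> b \<noteq> 0" "rim y \<noteq> rim w"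
    and x: "\<exists>t. map_of ms t = Some x" "2 * x \<le> m"
    and same_side: "\<And>y' x'. legal_move V E ms (y', x') \<Longrightarrow> rim y' = rim w \<Longrightarrow> x' \<noteq> m \<Longrightarrow>
      bob_wins V E first (ms @ [(y', x')]) \<or>
      (\<exists>z\<in>V. z \<noteq> w \<and> z \<noteq> y' \<and> rim z = rim w \<and>
        ({z, y} \<in> E \<longrightarrow> {y, w} \<in> E \<longrightarrow> 2 * x \<noteq> m))"
    and other_side: "\<And>y'. y' \<in> V \<Longrightarrow> rim y' \<noteq> rim w \<Longrightarrow> map_of ms y' = None \<Longrightarrow>
      \<exists>u z. {w, u} \<in> E \<and> map_of ms u = None \<and> u \<noteq> y' \<and>
        (\<forall>t. {w, t} \<in> E \<longrightarrow> t \<noteq> u \<longrightarrow> t \<noteq> z \<longrightarrow> map_of ms t \<noteq> None)"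
  shows "bob_wins V E first ms"
proof (rule bob_wins.alice[OF Alice])
  have cE: "card E = m" using n by (simp add: E_def m_def card_gear_edges)
  show "length ms < card V" using length n by (simp add: V_def card_gear_verts)
  fix mv assume "legal_move V E ms mv"
  then obtain y' x' where mv: "mv = (y', x')" and legal: "legal_move V E ms (y', x')"
    by (cases mv) auto
  note l = legal_moveD[OF legal]
  let ?ms = "ms @ [(y', x')]"
  have map: "map_of ?ms = (map_of ms)(y' \<mapsto> x')" using l(2) by (intro map_of_snoc) auto
  have play': "legal_play V E ?ms" using play legal by (rule legal_play.move)
  have Bob: "turn first ?ms = Bob"
    using Alice by (cases first) (auto simp: turn_def split: if_splits)
  have "y' \<noteq> w" using l(2) w(2) by auto
  have w': "map_of ?ms w = Some 0" using w(2) \<open>y' \<noteq> w\<close> unfolding map by simp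
  have "x' \<noteq> 0" using l(4)[of w] w(2) by auto
  have "bob_wins V E first ?ms"
  proof (cases "rim y' = rim w")
    case True
    show ?thesis
    proof (cases "x' = m")
      case m: True
      show ?thesis
      proof (rule bob_wins.doomed, rule doomed_if_extreme_labels_apart)
        show "simple_graph V E" unfolding V_def E_def by (rule simple_graph_gear)
        show "{w, y'} \<notin> E" using gear_edges_bipartite True unfolding E_def by blast
        show "map_of ?ms y' = Some (card E)" unfolding map using m cE by simp
        show "map_of ?ms w = Some 0" by (rule w')
      qed (use cE n w l m_def in auto)
    next
      case x': False
      from same_side[OF legal True x'] show ?thesis
      proof
        assume "\<exists>z\<in>V. z \<noteq> w \<and> z \<noteq> y' \<and> rim z = rim w \<and>
          ({z, y} \<in> E \<longrightarrow> {y, w} \<in> E \<longrightarrow> 2 * x \<noteq> m)"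
        then obtain z where z: "z \<in> V" "z \<noteq> w" "z \<noteq> y'" "rim z = rim w"
          "{z, y} \<in> E \<longrightarrow> {y, w} \<in> E \<longrightarrow> 2 * x \<noteq> m" by blast
        show ?thesis unfolding V_def E_def
        proof (rule bob_wins_by_separating_extremes[where w = w and y = y and x = x and z = z])
          show "map_of ?ms w = Some 0" by (rule w')
          show "t = y \<and> b = x" if "map_of ?ms t = Some b" "rim t \<noteq> rim w" for t b
            using that y(1)[of t b] True unfolding map by (auto split: if_splits)
          show "t = w" if "map_of ?ms t = Some 0" for t
            using that y(1)[of t 0] \<open>x' \<noteq> 0\<close> unfolding map by (auto split: if_splits)
          show "map_of ?ms z = None"
            using y(1)[of z] y(2) z unfolding map by (cases "map_of ms z") auto
          show "map_of ?ms t \<noteq> Some (3 * n)" for t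
            using y(1)[of t] w(2) x x' n unfolding map m_def
            by (cases "t = w") (auto split: if_splits)
        qed (use n play' Bob w z x V_def E_def m_def in auto)
      qed auto
    qed
  next
    case False
    obtain u z where u: "{w, u} \<in> E" "map_of ms u = None" "u \<noteq> y'"
      "\<And>t. {w, t} \<in> E \<Longrightarrow> t \<noteq> u \<Longrightarrow> t \<noteq> z \<Longrightarrow> map_of ms t \<noteq> None"
      using other_side[OF l(1) False l(2)] by blast
    show ?thesis unfolding V_def E_def
    proof (rule bob_wins_by_filling_neighbour[where w = w and x = x and x' = x' and u = u and z = z])
      show "map_of ?ms w = Some 0" by (rule w')
      show "rim t \<noteq> rim w" if "map_of ?ms t = Some b" "t \<noteq> w" for t b
        using that y False unfolding map by (auto split: if_splits)
      show "b \<in> {0, x, x'}" if "map_of ?ms t = Some b" for t b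
        using that y(1)[of t b] w(2) unfolding map by (cases "t = w") (auto split: if_splits)
      show "\<exists>t. map_of ?ms t = Some x" using x(1) l(2) unfolding map by force
      show "\<exists>t. map_of ?ms t = Some x'" unfolding map by auto
      show "map_of ?ms u = None" using u unfolding map by simp
      show "\<exists>b. map_of ?ms t = Some b \<and> b < 3 * n - 1"
        if t: "{w, t} \<in> gear_edges n" "t \<noteq> u" "t \<noteq> z" for t
      proof -
        obtain b where b: "map_of ms t = Some b" using u(4)[of t] t by (auto simp: E_def)
        moreover have "t \<noteq> w" using t(1) gear_edges_bipartite by blast
        moreover have "t \<noteq> y'" using b l(2) by auto
        \<comment> \<open>The label is \<open>x\<close>, at most \<open>m / 2\<close>, which is
          below \<open>m - 1\<close> because \<open>m \<ge> 9\<close>.\<close>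
        ultimately show ?thesis using y(1)[OF b] x(2) n unfolding map by (auto simp: m_def)
      qed
    qed (use n play' Bob w u V_def E_def in auto)
  qed
  then show "bob_wins V E first (ms @ [mv])" by (simp add: mv)
qed

section \<open>Neighbourhoods and opening moves\<close>

lemma gear_neighbours_Mid:
  "{Mid j, t} \<in> gear_edges n \<Longrightarrow> t = Rim j \<or> t = Rim (cyclic_Suc n j)"
  by (cases t) (auto dest: gear_edges_bipartite)

lemma gear_neighbours_Rim:
  "k < n \<Longrightarrow> {Rim k, t} \<in> gear_edges n \<Longrightarrow>
    t = Hub \<or> t = Mid k \<or> t = Mid (if k = 0 then n - 1 else k - 1)"
  by (cases t) (auto simp: cyclic_Suc_def dest: gear_edges_bipartite split: if_splits)

text \<open>Two labeled vertices span at most one edge, so no two edge labels can collide.\<close>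

lemma legal_play_two:
  assumes "n \<ge> 3" "y \<in> gear_verts n" "x \<le> 3 * n" "w \<in> gear_verts n" "y \<noteq> w" "b \<le> 3 * n" "x \<noteq> b"
  shows "legal_move (gear_verts n) (gear_edges n) [(y, x)] (w, b)"
    "legal_play (gear_verts n) (gear_edges n) [(y, x)]"
    "legal_play (gear_verts n) (gear_edges n) [(y, x), (w, b)]"
proof -
  let ?V = "gear_verts n" and ?E = "gear_edges n"
  have "legal_move ?V ?E [] (y, x)"
    using assms gear_edges_no_loop
    by (intro legal_move_one_neighbour legal_play.start) (auto simp: card_gear_edges)
  from legal_play.move[OF legal_play.start this]
  show play: "legal_play ?V ?E [(y, x)]" by simp
  show legal: "legal_move ?V ?E [(y, x)] (w, b)"
    by (rule legal_move_one_neighbour[OF play, where z = y])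
      (use assms gear_edges_no_loop in \<open>auto simp: card_gear_edges split: if_splits\<close>)
  from legal_play.move[OF play legal] show "legal_play ?V ?E [(y, x), (w, b)]" by simp
qed

lemma bob_wins_if_first:
  assumes n: "n \<ge> 3"
  shows "bob_wins (gear_verts n) (gear_edges n) Bob []"
proof (rule bob_wins.bob)
  let ?V = "gear_verts n" and ?E = "gear_edges n"
  show legal: "legal_move ?V ?E [] (Mid 0, 0)"
    using n gear_edges_no_loop
    by (intro legal_move_one_neighbour legal_play.start) auto
  show "bob_wins ?V ?E Bob ([] @ [(Mid 0, 0)])"
  \<comment> \<open>No second vertex is labeled yet: \<open>Rim 0\<close> is a placeholder on the
    opposite side, and \<open>x = 0\<close> is the label of \<open>Mid 0\<close> itself.\<close>
  proof (rule bob_wins_after_zero[OF n, where w = "Mid 0" and y = "Rim 0" and x = 0])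
    show "legal_play ?V ?E ([] @ [(Mid 0, 0)])"
      using legal_play.start legal by (rule legal_play.move)
    fix y'
    \<comment> \<open>Bob fills a neighbour of \<open>Mid 0\<close> that Alice did not take.\<close>
    let ?u = "if y' = Rim 0 then Rim 1 else Rim 0" and ?z = "if y' = Rim 0 then Rim 0 else Rim 1"
    show "\<exists>u z. {Mid 0, u} \<in> ?E \<and> map_of ([] @ [(Mid 0, 0)]) u = None \<and> u \<noteq> y' \<and>
        (\<forall>t. {Mid 0, t} \<in> ?E \<longrightarrow> t \<noteq> u \<longrightarrow> t \<noteq> z \<longrightarrow> map_of ([] @ [(Mid 0, 0)]) t \<noteq> None)"
      by (rule exI[of _ ?u], rule exI[of _ ?z]) (use n in \<open>auto simp: cyclic_Suc_def dest!: gear_neighbours_Mid\<close>)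
    fix x'
    show "bob_wins ?V ?E Bob (([] @ [(Mid 0, 0)]) @ [(y', x')]) \<or>
      (\<exists>z\<in>?V. z \<noteq> Mid 0 \<and> z \<noteq> y' \<and> rim z = rim (Mid 0) \<and>
        ({z, Rim 0} \<in> ?E \<longrightarrow> {Rim 0, Mid 0} \<in> ?E \<longrightarrow> 2 * 0 \<noteq> 3 * n))"
      by (rule disjI2, rule bexI[of _ "if y' = Hub then Mid 1 else Hub"]) (use n in auto)
  qed (use n in \<open>auto simp: turn_def split: if_splits\<close>)
qed (simp add: turn_def)

text \<open>Here \<open>3 * n\<close> on another rim vertex would be illegal: its edge to the hub
  would repeat the label \<open>x\<close> of the edge from the hub to \<open>Rim 0\<close>. Bob uses
  a subdivision vertex instead.\<close>

lemma bob_wins_half_at_hub: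
  fixes n x x' k :: nat
  defines "V \<equiv> gear_verts n" and "E \<equiv> gear_edges n"
  defines "ms \<equiv> [(Hub, x), (Rim 0, 0)]"
  assumes n: "n \<ge> 3" and half: "2 * x = 3 * n"
    and legal: "legal_move V E ms (Rim k, x')" and x': "x' \<noteq> 3 * n"
  shows "bob_wins V E Alice (ms @ [(Rim k, x')])"
proof -
  have cE: "card E = 3 * n" using n by (simp add: E_def card_gear_edges)
  have play: "legal_play V E ms"
    unfolding V_def E_def ms_def using n half by (intro legal_play_two(3)) auto
  note l = legal_moveD[OF legal]
  have k: "k < n" "k \<noteq> 0" using l(1,2) by (auto simp: V_def ms_def split: if_splits)
  have x'': "x' \<le> 3 * n" "x' \<noteq> 0" "x' \<noteq> x"
    using l(3) l(4)[of "Rim 0"] l(4)[of Hub] by (auto simp: ms_def cE)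
  let ?ms = "ms @ [(Rim k, x')]"
  have play': "legal_play V E ?ms" using play legal by (rule legal_play.move)
  have Bob: "turn Alice ?ms = Bob" by (simp add: turn_def ms_def)
  have map: "map_of ?ms t = Some b \<longleftrightarrow>
      t = Hub \<and> b = x \<or> t = Rim 0 \<and> b = 0 \<or> t = Rim k \<and> b = x'" for t b
    using k by (auto simp: ms_def split: if_splits)
  have edge: "\<bar>int c - int c'\<bar> = int x \<or> \<bar>int c - int c'\<bar> = \<bar>int x - int x'\<bar>"
    if "{s, s'} \<in> E" "map_of ?ms s = Some c" "map_of ?ms s' = Some c'" for s s' c c'
    using that gear_edges_bipartite[of s s' n] unfolding map E_def
    by (auto simp: abs_minus_commute)
  show ?thesis
  \<comment> \<open>If \<open>Rim k\<close> is adjacent to \<open>Mid 1\<close>, then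
    \<open>3 * n\<close> on \<open>Mid 1\<close> creates the edge label \<open>3 * n - x'\<close>.
    It repeats an old one only when it equals \<open>x' - x\<close>, that is, when
    \<open>4 * x' = 9 * n\<close>.\<close>
  proof (cases "4 * x' = 9 * n")
    case False
    have "legal_move V E ?ms (Mid 1, 3 * n)"
    proof (rule legal_move_one_neighbour[OF play', where z = "Rim k"])
      show "map_of ?ms t \<noteq> Some (3 * n)" for t using map half n x' by auto
      show "t = Rim k" if "{Mid 1, t} \<in> E" "map_of ?ms t = Some b" for t b
        using that n unfolding map E_def
        by (auto dest: gear_edges_bipartite simp: cyclic_Suc_def split: if_splits)
      fix b s s' c c'
      assume "map_of ?ms (Rim k) = Some b" "{s, s'} \<in> E" "map_of ?ms s = Some c"
        "map_of ?ms s' = Some c'"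
      then show "\<bar>int (3 * n) - int b\<bar> \<noteq> \<bar>int c - int c'\<bar>"
        using edge[of s s' c c'] x'' half k False unfolding map by auto
    qed (use n gear_edges_no_loop in \<open>auto simp: V_def E_def ms_def card_gear_edges\<close>)
    moreover have "doomed V E (?ms @ [(Mid 1, 3 * n)])"
      by (rule doomed_if_extreme_labels_apart[where u = "Rim 0" and v = "Mid 1"])
        (use n simple_graph_gear k in
          \<open>auto simp: V_def E_def ms_def card_gear_edges cyclic_Suc_def split: if_splits\<close>)
    ultimately show ?thesis using bob_wins_by_killing_move[OF Bob] by blast
  next
    case True
    \<comment> \<open>\<open>u\<close> is a subdivision neighbour of \<open>Rim 0\<close> not
      adjacent to \<open>Rim k\<close>, so that 1 on it creates only the edge label 1;
      \<open>z\<close> is the other one.\<close>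
    define u where "u = (if k = 1 then Mid (n - 1) else Mid 0)"
    define z where "z = (if k = 1 then Mid 0 else Mid (n - 1))"
    have "legal_move V E ?ms (u, 1)"
    proof (rule legal_move_one_neighbour[OF play', where z = "Rim 0"])
      show "map_of ?ms t \<noteq> Some 1" for t unfolding map using half True n by auto
      show "t = Rim 0" if "{u, t} \<in> E" "map_of ?ms t = Some b" for t b
        using that n k unfolding map E_def u_def
        by (auto dest: gear_edges_bipartite simp: cyclic_Suc_def split: if_splits)
      fix b s s' c c'
      assume "map_of ?ms (Rim 0) = Some b" "{s, s'} \<in> E" "map_of ?ms s = Some c"
        "map_of ?ms s' = Some c'"
      then show "\<bar>int 1 - int b\<bar> \<noteq> \<bar>int c - int c'\<bar>"
        using edge[of s s' c c'] half True k n unfolding map by auto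
    qed (use n gear_edges_no_loop in \<open>auto simp: V_def E_def ms_def u_def card_gear_edges\<close>)
    moreover have "doomed V E (?ms @ [(u, 1)])"
    proof (rule doomed_if_one_open_neighbour[where w = "Rim 0" and q = u and z = z])
      show "{u, t} \<notin> E" if "{Rim 0, t} \<in> E" for t
        using that unfolding E_def u_def by (auto dest!: gear_edges_bipartite)
      show "\<exists>b. map_of (?ms @ [(u, 1)]) t = Some b \<and> b \<noteq> card E \<and> b \<noteq> card E - 1"
        if "{Rim 0, t} \<in> E" "t \<noteq> z" for t
      proof -
        have "t = Hub \<or> t = u"
          using gear_neighbours_Rim[of 0 n t] that n unfolding E_def u_def z_def
          by (auto split: if_splits)
        then show ?thesis using half n by (auto simp: ms_def u_def cE)
      qed
    qed (use n simple_graph_gear in \<open>auto simp: V_def E_def ms_def u_def card_gear_edges\<close>)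
    ultimately show ?thesis using bob_wins_by_killing_move[OF Bob] by blast
  qed
qed

text \<open>A first label 0 is answered by \<open>3 * n\<close> on the same side. Otherwise Bob puts
  0 opposite Alice's vertex, on a vertex that has exactly two free neighbours.\<close>

lemma bob_wins_after_first_move:
  fixes n :: nat
  defines "V \<equiv> gear_verts n" and "E \<equiv> gear_edges n"
  assumes n: "n \<ge> 3" and y: "y \<in> V" and x: "2 * x \<le> 3 * n"
  shows "bob_wins V E Alice [(y, x)]"
proof -
  have Bob: "turn Alice [(y, x)] = Bob" by (simp add: turn_def)
  have reply: "bob_wins V E Alice [(y, x)]"
    if "w \<in> V" "w \<noteq> y" "x \<noteq> 0" "bob_wins V E Alice [(y, x), (w, 0)]" for w
    by (rule bob_wins.bob[OF Bob, where mv = "(w, 0)"])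
      (use that n y x in \<open>auto simp: V_def E_def intro: legal_play_two(1)\<close>)
  consider "x = 0" | "x \<noteq> 0" "y = Hub" | j where "x \<noteq> 0" "y = Rim j" | j where "x \<noteq> 0" "y = Mid j"
    by (cases y) auto
  then show ?thesis
  proof cases
    case 1
    define z where
      "z = (case y of Hub \<Rightarrow> Mid 0 | Mid j \<Rightarrow> Hub | Rim j \<Rightarrow> if j = 0 then Rim 1 else Rim 0)"
    have z: "z \<in> V" "z \<noteq> y" "rim z = rim y"
      using n by (auto simp: z_def V_def split: gear_vertex.splits)
    have "legal_move V E [(y, x)] (z, 3 * n)"
      unfolding V_def E_def using z n y 1 by (intro legal_play_two(1)) (auto simp: V_def)
    moreover have "doomed V E ([(y, x)] @ [(z, 3 * n)])"
      by (rule doomed_if_extreme_labels_apart[where u = y and v = z])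
        (use n y z 1 gear_edges_bipartite[of y z n] simple_graph_gear in
          \<open>auto simp: V_def E_def card_gear_edges\<close>)
    ultimately show ?thesis using bob_wins_by_killing_move[OF Bob] by blast
  next
    case 2
    let ?ms = "[(Hub, x), (Rim 0, 0)]"
    have "bob_wins V E Alice ?ms"
      unfolding V_def E_def
    proof (rule bob_wins_after_zero[OF n, where w = "Rim 0" and y = Hub and x = x])
      show "legal_play (gear_verts n) (gear_edges n) ?ms"
        using n x 2 by (intro legal_play_two(3)) auto
      fix y'
      let ?u = "if y' = Mid 0 then Mid (n - 1) else Mid 0"
        and ?z = "if y' = Mid 0 then Mid 0 else Mid (n - 1)"
      show "\<exists>u z. {Rim 0, u} \<in> gear_edges n \<and> map_of ?ms u = None \<and> u \<noteq> y' \<and>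
          (\<forall>t. {Rim 0, t} \<in> gear_edges n \<longrightarrow> t \<noteq> u \<longrightarrow> t \<noteq> z \<longrightarrow> map_of ?ms t \<noteq> None)"
        by (rule exI[of _ ?u], rule exI[of _ ?z])
          (use n in \<open>auto simp: cyclic_Suc_def dest!: gear_neighbours_Rim[rotated]\<close>)
      fix x'
      assume legal: "legal_move (gear_verts n) (gear_edges n) ?ms (y', x')"
        and y': "rim y' = rim (Rim 0)" and x': "x' \<noteq> 3 * n"
      obtain k where k: "y' = Rim k" using y' by (auto simp: rim_def)
      show "bob_wins (gear_verts n) (gear_edges n) Alice (?ms @ [(y', x')]) \<or>
        (\<exists>z\<in>gear_verts n. z \<noteq> Rim 0 \<and> z \<noteq> y' \<and> rim z = rim (Rim 0) \<and>
          ({z, Hub} \<in> gear_edges n \<longrightarrow> {Hub, Rim 0} \<in> gear_edges n \<longrightarrow> 2 * x \<noteq> 3 * n))"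
      proof (cases "2 * x = 3 * n")
        case True
        then show ?thesis using bob_wins_half_at_hub[OF n True] legal x' k by blast
      next
        case False
        then show ?thesis
          by (intro disjI2 bexI[of _ "if k = 1 then Rim 2 else Rim 1"]) (use n k in auto)
      qed
    qed (use n x 2 in \<open>auto simp: turn_def split: if_splits\<close>)
    then show ?thesis using reply[of "Rim 0"] 2 n by (auto simp: V_def)
  next
    case (3 j)
    \<comment> \<open>With this choice \<open>Mid i\<close> is not adjacent to \<open>Rim j\<close>,
      so the exclusion of \<open>2 * x = 3 * n\<close> is vacuous.\<close>
    define i where "i = cyclic_Suc n j"
    have j: "j < n" using y 3 by (simp add: V_def)
    have i: "i < n" "j \<noteq> i" "j \<noteq> cyclic_Suc n i"
      using j n by (auto simp: i_def cyclic_Suc_def split: if_splits)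
    let ?w = "Mid i" and ?y = "Rim j"
    let ?ms = "[(?y, x), (?w, 0)]"
    have "bob_wins V E Alice ?ms"
      unfolding V_def E_def
    proof (rule bob_wins_after_zero[OF n, where w = ?w and y = ?y and x = x])
      show "legal_play (gear_verts n) (gear_edges n) ?ms"
        using n x 3 i j by (intro legal_play_two(3)) auto
      fix y'
      let ?u = "if y' = Rim i then Rim (cyclic_Suc n i) else Rim i"
        and ?z = "if y' = Rim i then Rim i else Rim (cyclic_Suc n i)"
      have "cyclic_Suc n i \<noteq> i" using i n by (auto simp: cyclic_Suc_def)
      then show "\<exists>u z. {?w, u} \<in> gear_edges n \<and> map_of ?ms u = None \<and> u \<noteq> y' \<and>
          (\<forall>t. {?w, t} \<in> gear_edges n \<longrightarrow> t \<noteq> u \<longrightarrow> t \<noteq> z \<longrightarrow> map_of ?ms t \<noteq> None)"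
        by (intro exI[of _ ?u] exI[of _ ?z]) (use i in \<open>auto dest!: gear_neighbours_Mid\<close>)
      fix x'
      let ?z = "if y' \<noteq> Hub then Hub else if i = 0 then Mid 1 else Mid 0"
      show "bob_wins (gear_verts n) (gear_edges n) Alice (?ms @ [(y', x')]) \<or>
        (\<exists>z\<in>gear_verts n. z \<noteq> ?w \<and> z \<noteq> y' \<and> rim z = rim ?w \<and>
          ({z, ?y} \<in> gear_edges n \<longrightarrow> {?y, ?w} \<in> gear_edges n \<longrightarrow> 2 * x \<noteq> 3 * n))"
        by (rule disjI2, rule bexI[of _ ?z]) (use n i in auto)
    qed (use n x 3 i in \<open>auto simp: turn_def split: if_splits\<close>)
    then show ?thesis using reply[of ?w] 3 i by (auto simp: V_def)
  next
    case (4 j)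
    have j: "j < n" using y 4 by (simp add: V_def)
    \<comment> \<open>\<open>Mid i\<close> is the other subdivision vertex next to
      \<open>Rim j\<close>.\<close>
    define i where "i = (if j = 0 then n - 1 else j - 1)"
    have i: "i < n" "i \<noteq> j" "cyclic_Suc n i = j" using j n by (auto simp: i_def cyclic_Suc_def)
    have edge: "{Rim j, Mid i} \<in> gear_edges n" using i by simp
    have N: "t = Hub \<or> t = Mid j \<or> t = Mid i" if "{Rim j, t} \<in> gear_edges n" for t
      using gear_neighbours_Rim[OF j that] by (simp only: i_def)
    let ?w = "Rim j" and ?y = "Mid j"
    let ?ms = "[(?y, x), (?w, 0)]"
    have "bob_wins V E Alice ?ms"
      unfolding V_def E_def
    proof (rule bob_wins_after_zero[OF n, where w = ?w and y = ?y and x = x])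
      show "legal_play (gear_verts n) (gear_edges n) ?ms"
        using n x 4 j by (intro legal_play_two(3)) auto
      fix y'
      let ?u = "if y' = Hub then Mid i else Hub" and ?z = "if y' = Hub then Hub else Mid i"
      show "\<exists>u z. {?w, u} \<in> gear_edges n \<and> map_of ?ms u = None \<and> u \<noteq> y' \<and>
          (\<forall>t. {?w, t} \<in> gear_edges n \<longrightarrow> t \<noteq> u \<longrightarrow> t \<noteq> z \<longrightarrow> map_of ?ms t \<noteq> None)"
        by (rule exI[of _ ?u], rule exI[of _ ?z]) (use edge i(2) j N in auto)
      fix x'
      have "\<exists>z\<in>gear_verts n. z \<noteq> ?w \<and> z \<noteq> y' \<and> rim z = rim ?w \<and>
          ({z, ?y} \<in> gear_edges n \<longrightarrow> {?y, ?w} \<in> gear_edges n \<longrightarrow> 2 * x \<noteq> 3 * n)"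
      \<comment> \<open>For \<open>n = 3\<close> the number of edges is odd, so
        \<open>2 * x \<noteq> 3 * n\<close> and any third rim vertex serves. For
        \<open>n \<ge> 4\<close> some rim vertex also avoids the second neighbour of
        \<open>Mid j\<close>.\<close>
      proof (cases "n = 3")
        case True
        have "\<exists>k\<in>{0, 1, 2}. k \<noteq> j \<and> y' \<noteq> Rim k" by (cases y') auto
        then obtain k where "k \<in> {0, 1, 2}" "k \<noteq> j" "y' \<noteq> Rim k" by blast
        moreover from this have "k < n" using True by auto
        moreover have "2 * x \<noteq> 3 * n" using True by presburger
        ultimately show ?thesis by (intro bexI[of _ "Rim k"]) auto
      next
        case False
        have "\<exists>k\<in>{0, 1, 2, 3}. k \<noteq> j \<and> k \<noteq> cyclic_Suc n j \<and> y' \<noteq> Rim k"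
          by (cases y') auto
        then obtain k where "k \<in> {0, 1, 2, 3}" "k \<noteq> j" "k \<noteq> cyclic_Suc n j" "y' \<noteq> Rim k"
          by blast
        moreover from this have "k < n" using False n by auto
        ultimately show ?thesis by (intro bexI[of _ "Rim k"]) auto
      qed
      then show "bob_wins (gear_verts n) (gear_edges n) Alice (?ms @ [(y', x')]) \<or>
        (\<exists>z\<in>gear_verts n. z \<noteq> ?w \<and> z \<noteq> y' \<and> rim z = rim ?w \<and>
          ({z, ?y} \<in> gear_edges n \<longrightarrow> {?y, ?w} \<in> gear_edges n \<longrightarrow> 2 * x \<noteq> 3 * n))" ..
    qed (use n x 4 j in \<open>auto simp: turn_def split: if_splits\<close>)
    then show ?thesis using reply[of ?w] 4 j by (auto simp: V_def)
  qed
qed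

lemma bob_wins_if_second:
  assumes n: "n \<ge> 3"
  shows "bob_wins (gear_verts n) (gear_edges n) Alice []"
proof (rule bob_wins.alice)
  let ?V = "gear_verts n" and ?E = "gear_edges n"
  fix mv assume "legal_move ?V ?E [] mv"
  then obtain y x where mv: "mv = (y, x)" and y: "y \<in> ?V" "x \<le> card ?E"
    by (cases mv) (auto simp: legal_move_def Let_def)
  show "bob_wins ?V ?E Alice ([] @ [mv])"
  proof (cases "2 * x \<le> 3 * n")
    case True
    then show ?thesis using bob_wins_after_first_move[OF n y(1)] mv by simp
  next
    case False
    \<comment> \<open>A label above the middle is reflected to one below it, and Bob's win is
      reflected back.\<close>
    then have "2 * (card ?E - x) \<le> 3 * n" using n by (simp add: card_gear_edges)
    then have "bob_wins ?V ?E Alice [(y, card ?E - x)]"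
      by (rule bob_wins_after_first_move[OF n y(1)])
    then have "bob_wins ?V ?E Alice (complement_play (card ?E) [(y, card ?E - x)])"
      by (rule bob_wins_complement) (auto dest: gear_edges_in_verts)
    then show ?thesis using y by (simp add: complement_play_def mv)
  qed
qed (auto simp: turn_def card_gear_verts)

theorem theorem8:
  fixes n :: nat and first :: player
  assumes "n \<ge> 3"
  shows "\<exists>\<sigma>. bob_winning_strategy (gear_verts n) (gear_edges n) first \<sigma>"
  using bob_wins_if_first[OF assms] bob_wins_if_second[OF assms]
  by (cases first) (auto intro: bob_winning_strategy_if_bob_wins)

end
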